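(* Let $\phi:E\to\,]-\infty,+\infty]$ be proper and lower semicontinuous. Let $(x_n)_{n\in\mathbb{N}}$ and $x$ be in $\operatorname{dom} I_\phi$. Assume that there exists $\delta>0$ such that $\|v^*\|\le\delta$ for every $v\in E$ and every $v^*\in\partial_C\phi(v)$, i.e. $\sup_{(v,v^* )\in\operatorname{gra}\partial_C\phi}\|v^*\|\le\delta$. Suppose that $(x_n)_{n\in\mathbb{N}}$ converges to $x$ in measure and that there exists $M>0$ such that $|\phi(v)|\le M$ for all $v\in\operatorname{dom}\phi$. Then $I_\phi(x_n)\to I_\phi(x)$.
   Context: $d\in\{1,2,3,\dots\}$ and $E=\mathbb{R}^d$ is Euclidean space with its Euclidean norm. $(S,\mu)$ is a complete finite measure space with $\mu\neq 0$. $L^1_E(S,\mu)$ is the Banach space of (equivalence classes of) measurable $f:S\to E$ with $\int_S\|f(s)\|\,d\mu(s)<+\infty$. For $f$ with values in $]-\infty,+\infty]$, $\operatorname{dom} f:=\{x:f(x)<+\infty\}$, and $f$ is proper if $\operatorname{dom} f\ne\varnothing$. The integral functional is $I_\phi:L^1_E(S,\mu)\to\,]-\infty,+\infty]$, $I_\phi(x):=\int_S\phi(x(s))\,d\mu(s)$. A sequence $(x_n)$ converges to $x$ in measure if for every $\eta>0$, $\lim_{n}\mu\{s\in S:\|x_n(s)-x(s)\|\ge\eta\}=0$. Clarke subdifferential: for $f:X\to\,]-\infty,+\infty]$ on a Banach space $X$, lower semicontinuous at $x_0\in\operatorname{dom} f$, the Clarke--Rockafellar directional derivative is $$f^{\uparrow}(x_0;v):=\sup_{\varepsilon>0}\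 \limsup_{t\downarrow0,\ x\to_f x_0}\ \inf_{\|u-v\|\le\varepsilon}\frac{f(x+tu)-f(x)}{t},\qquad v\in X,$$ where $x\to_f x_0$ means $x\to x_0$ and $f(x)\to f(x_0)$. Then $\partial_C f(x_0):=\{x^*\in X^*:\langle x^*,v\rangle\le f^{\uparrow}(x_0;v)\ \forall v\in X\}$ for $x_0\in\operatorname{dom} f$ (and $\partial_C f(x_0)=\varnothing$ for $x_0\notin\operatorname{dom} f$); $\operatorname{gra}\partial_C f=\{(x,x^* ):x^*\in\partial_C f(x)\}$. *)

theory Defs
  imports "HOL-Analysis.Analysis"
begin

(* Functions with values in ]-\<infinity>, +\<infinity>] are ereal-valued functions; that the value -\<infinity> is not
   attained is a separate hypothesis wherever it is needed. *)

definition edom :: "('a \<Rightarrow> ereal) \<Rightarrow> 'a set" where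
  "edom f = {x. f x < \<infinity>}"

definition proper :: "('a \<Rightarrow> ereal) \<Rightarrow> bool" where
  "proper f \<longleftrightarrow> edom f \<noteq> {}"

definition lsc :: "('a::topological_space \<Rightarrow> ereal) \<Rightarrow> bool" where
  "lsc f \<longleftrightarrow> (\<forall>x. f x \<le> Liminf (nhds x) f)"

(* The filter of x \<rightarrow>_f x0: x \<rightarrow> x0 together with f x \<rightarrow> f x0. *)
definition f_nhds :: "('a::topological_space \<Rightarrow> ereal) \<Rightarrow> 'a \<Rightarrow> 'a filter" where
  "f_nhds f x0 = inf (nhds x0) (filtercomap f (nhds (f x0)))"

(* Clarke-Rockafellar directional derivative. It is only meaningful when f x0 is finite; then f x
   is finite eventually along f_nhds f x0, so the difference below is never \<infinity> - \<infinity> there. *)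
definition cr_deriv :: "('a::real_normed_vector \<Rightarrow> ereal) \<Rightarrow> 'a \<Rightarrow> 'a \<Rightarrow> ereal" where
  "cr_deriv f x0 v =
     (SUP \<epsilon>\<in>{0<..}. Limsup (at_right 0 \<times>\<^sub>F f_nhds f x0)
        (\<lambda>(t::real, x). INF u\<in>{u. norm (u - v) \<le> \<epsilon>}. (f (x + t *\<^sub>R u) - f x) / ereal t))"

definition clarke_subdiff :: "('a::banach \<Rightarrow> ereal) \<Rightarrow> 'a \<Rightarrow> ('a \<Rightarrow>\<^sub>L real) set" where
  "clarke_subdiff f x0 =
     (if x0 \<in> edom f then {xs. \<forall>v. ereal (blinfun_apply xs v) \<le> cr_deriv f x0 v} else {})"

definition gra :: "('a \<Rightarrow> 'b set) \<Rightarrow> ('a \<times> 'b) set" where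
  "gra A = {(x, xs). xs \<in> A x}"

(* Extended-valued integral: integral of the positive part minus integral of the negative part
   (e2ennreal truncates at 0). By ereal arithmetic, \<infinity> - \<infinity> = \<infinity>, the usual convention of convex
   analysis. *)
definition eintegral :: "'s measure \<Rightarrow> ('s \<Rightarrow> ereal) \<Rightarrow> ereal" where
  "eintegral M g =
     enn2ereal (\<integral>\<^sup>+ s. e2ennreal (g s) \<partial>M) - enn2ereal (\<integral>\<^sup>+ s. e2ennreal (- g s) \<partial>M)"

definition int_functional :: "'s measure \<Rightarrow> ('e \<Rightarrow> ereal) \<Rightarrow> ('s \<Rightarrow> 'e) \<Rightarrow> ereal" where
  "int_functional M \<phi> x = eintegral M (\<lambda>s. \<phi> (x s))"

(* Elements of L^1 are given by their integrable representatives. *)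
definition dom_int_functional ::
    "'s measure \<Rightarrow> ('e::{banach,second_countable_topology} \<Rightarrow> ereal) \<Rightarrow> ('s \<Rightarrow> 'e) set" where
  "dom_int_functional M \<phi> = {x. integrable M x \<and> int_functional M \<phi> x < \<infinity>}"

definition tendsto_in_measure ::
    "'s measure \<Rightarrow> (nat \<Rightarrow> 's \<Rightarrow> 'e::real_normed_vector) \<Rightarrow> ('s \<Rightarrow> 'e) \<Rightarrow> bool" where
  "tendsto_in_measure M xs x \<longleftrightarrow>
     (\<forall>\<eta>>0. (\<lambda>n. measure M {s \<in> space M. norm (xs n s - x s) \<ge> \<eta>}) \<longlonglongrightarrow> 0)"

end

theory Submission
  imports Defs
begin

text \<open>
  For every \<open>y\<close> and every \<open>K\<close> larger than the bound \<open>\<delta>\<close> on the subgradients, \<open>\<phi> + K\<bar>\<cdot> - y\<bar>\<close>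
  attains its minimum at some \<open>z\<close>. If \<open>z \<noteq> y\<close>, then \<open>K\<bar>\<cdot> - y\<bar>\<close> is smooth near \<open>z\<close>, so minus its
  gradient at \<open>z\<close>, a vector of norm \<open>K > \<delta>\<close>, is a proximal and hence a Clarke subgradient of \<open>\<phi>\<close>;
  this is impossible. So \<open>y\<close> itself is the minimiser for all \<open>y\<close>: \<open>\<phi>\<close> is finite everywhere and
  \<open>K\<close>-Lipschitz. For a bounded Lipschitz integrand, convergence in measure passes to the integrals.
\<close>

section \<open>Proximal subgradients are Clarke subgradients\<close>

text \<open>The limsup over \<open>x\<close> tending to \<open>z\<close> is at least the limsup
  along the constant choice \<open>x = z\<close>. There the minorant bounds the difference quotient
  in direction \<open>u\<close> below by \<open>p u - t * (c * (norm u)\<^sup>2)\<close>, which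
  tends to \<open>p u\<close> as \<open>t\<close> decreases to 0, and \<open>p u\<close> is close to
  \<open>p v\<close> for \<open>u\<close> near \<open>v\<close>.\<close>

lemma proximal_subgradient_in_clarke_subdiff:
  fixes f :: "'a::banach \<Rightarrow> ereal" and p :: "'a \<Rightarrow>\<^sub>L real"
  assumes fz: "f z = ereal r" and c: "c \<ge> 0"
    and minorant: "\<And>w. ereal (r + p (w - z) - c * (norm (w - z))\<^sup>2) \<le> f w"
  shows "p \<in> clarke_subdiff f z"
proof -
  have "ereal (p v) \<le> cr_deriv f z v" for v
  proof (rule ereal_le_real)
    have "ereal b \<le> cr_deriv f z v" if b: "b < p v" for b
    proof -
      \<comment> \<open>The gap \<open>p v - b\<close> is split in two: replacing \<open>v\<close>
        by \<open>u\<close> costs at most one half, the quadratic term the other. The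
        \<open>+ 1\<close> keeps the divisor positive when \<open>p = 0\<close>.\<close>
      define \<epsilon> where "\<epsilon> = (p v - b) / (2 * (norm p + 1))"
      have np: "norm p + 1 > 0" by (simp add: add_nonneg_pos)
      have "\<epsilon> > 0" using b np by (simp add: \<epsilon>_def)
      moreover from this have "norm p * \<epsilon> \<le> (norm p + 1) * \<epsilon>" by simp
      moreover have "(norm p + 1) * \<epsilon> = (p v - b) / 2" using np by (simp add: \<epsilon>_def divide_simps)
      ultimately have \<epsilon>: "\<epsilon> > 0" "norm p * \<epsilon> \<le> (p v - b) / 2" by simp_all
      \<comment> \<open>Bounds \<open>c * (norm u)\<^sup>2\<close> for all admissible
        \<open>u\<close>; the \<open>+ 1\<close> allows division by \<open>A\<close> even if
        \<open>c = 0\<close>.\<close>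
      define A where "A = c * (norm v + \<epsilon>)\<^sup>2 + 1"
      have A: "A > 0" using c by (simp add: A_def add_nonneg_pos)
      define q where "q = (\<lambda>(t::real, x). INF u\<in>{u. norm (u - v) \<le> \<epsilon>}. (f (x + t *\<^sub>R u) - f x) / ereal t)"
      have q: "ereal b \<le> q (t, z)" if t: "0 < t" "t < (p v - b) / (2 * A)" for t
        unfolding q_def prod.case
      proof (rule INF_greatest)
        fix u assume "u \<in> {u. norm (u - v) \<le> \<epsilon>}"
        then have u: "norm (u - v) \<le> \<epsilon>" by simp
        have "\<bar>p (u - v)\<bar> \<le> norm p * norm (u - v)"
          using norm_blinfun[of p "u - v"] by simp
        also have "\<dots> \<le> norm p * \<epsilon>" using u by (intro mult_left_mono) auto
        finally have 1: "p u \<ge> p v - (p v - b) / 2"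
          using \<epsilon>(2) unfolding blinfun.diff_right by linarith
        have "norm u \<le> norm v + \<epsilon>" using u norm_triangle_sub[of u v] by linarith
        then have "c * (norm u)\<^sup>2 \<le> A"
          using c by (auto simp: A_def intro!: mult_left_mono power_mono add_increasing2)
        then have "t * (c * (norm u)\<^sup>2) \<le> t * A" using t by (intro mult_left_mono) auto
        also have "\<dots> \<le> (p v - b) / 2" using t A by (simp add: field_simps)
        finally have "t * (c * (norm u)\<^sup>2) \<le> (p v - b) / 2" .
        from add_mono[OF 1 this] have "b \<le> p u - t * (c * (norm u)\<^sup>2)"
          by (simp add: field_simps)
        then have "t * b \<le> t * (p u - t * (c * (norm u)\<^sup>2))" using t by (intro mult_left_mono) auto
        then have "ereal (r + t * b) \<le> ereal (r + p (z + t *\<^sub>R u - z) - c * (norm (z + t *\<^sub>R u - z))\<^sup>2)"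
          using t by (simp add: blinfun.scaleR_right power_mult_distrib algebra_simps power2_eq_square)
        also have "\<dots> \<le> f (z + t *\<^sub>R u)" by (rule minorant)
        finally have 2: "ereal (r + t * b) \<le> f (z + t *\<^sub>R u)" .
        show "ereal b \<le> (f (z + t *\<^sub>R u) - f z) / ereal t"
          using 2 t fz by (cases "f (z + t *\<^sub>R u)") (auto simp: field_simps)
      qed
      have "ereal b \<le> Limsup (at_right 0 \<times>\<^sub>F f_nhds f z) q"
      proof (rule Limsup_greatest)
        fix P assume "eventually P (at_right (0::real) \<times>\<^sub>F f_nhds f z)"
        then obtain Pf Pg where P: "eventually Pf (at_right (0::real))" "eventually Pg (f_nhds f z)"
            "\<And>t x. Pf t \<Longrightarrow> Pg x \<Longrightarrow> P (t, x)"
          unfolding eventually_prod_filter by blast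
        \<comment> \<open>Neither filter in \<open>f_nhds\<close> is punctured, so \<open>z\<close>
          itself satisfies whatever holds eventually; this permits the base point
          \<open>x = z\<close>.\<close>
        have "Pg z"
          using P(2) unfolding f_nhds_def eventually_inf eventually_filtercomap
          by (metis eventually_nhds_x_imp_x)
        have "(p v - b) / (2 * A) > 0" using b A by simp
        then have "eventually (\<lambda>t. 0 < t \<and> t < (p v - b) / (2 * A)) (at_right 0)"
          by (auto simp: eventually_at_right_field)
        then have "eventually (\<lambda>t. Pf t \<and> 0 < t \<and> t < (p v - b) / (2 * A)) (at_right 0)"
          using P(1) by eventually_elim auto
        then obtain t where t: "Pf t" "0 < t" "t < (p v - b) / (2 * A)"
          using eventually_happens'[OF trivial_limit_at_right_real] by blast
        then show "ereal b \<le> Sup (q ` Collect P)"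
          using q[of t] P(3) \<open>Pg z\<close> by (intro SUP_upper2[of "(t, z)"]) auto
      qed
      also have "\<dots> \<le> cr_deriv f z v"
        unfolding cr_deriv_def q_def using \<epsilon> by (intro SUP_upper) auto
      finally show ?thesis .
    qed
    then show "ereal (p v) \<le> ereal y" if "cr_deriv f z v \<le> ereal y" for y
      using that by (meson dense_le ereal_less_eq(3) order_trans)
  qed
  then show ?thesis using fz by (simp add: clarke_subdiff_def edom_def)
qed

section \<open>Bounded Clarke subgradients force finiteness and the Lipschitz property\<close>

text \<open>Weierstrass for lower semicontinuous functions: without a minimiser, the open sets
  \<open>{z. g w < g z}\<close> with \<open>w\<close> in \<open>C\<close> would cover
  \<open>C\<close>; in a finite subcover, the index with the least value of \<open>g\<close> would
  lie in none of them.\<close>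

lemma compact_attains_inf_of_open_superlevel:
  fixes g :: "'a::topological_space \<Rightarrow> 'b::linorder"
  assumes "compact C" "C \<noteq> {}" and op: "\<And>c. open {z. c < g z}"
  shows "\<exists>z\<in>C. \<forall>w\<in>C. g z \<le> g w"
proof (rule ccontr)
  assume "\<not> ?thesis"
  then have "C \<subseteq> (\<Union>w\<in>C. {z. g w < g z})" by (fastforce simp: not_le)
  from compactE_image[OF \<open>compact C\<close> op this] obtain W
    where W: "W \<subseteq> C" "finite W" "C \<subseteq> (\<Union>w\<in>W. {z. g w < g z})" by metis
  then have "W \<noteq> {}" using \<open>C \<noteq> {}\<close> by auto
  then obtain w where "w \<in> W" "\<And>w'. w' \<in> W \<Longrightarrow> g w \<le> g w'"
    using W(2) by (metis arg_min_if_finite(1) arg_min_least)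
  then show False using W(1,3) by fastforce
qed

lemma lsc_add_continuous_open_superlevel:
  fixes f :: "'a::topological_space \<Rightarrow> ereal" and h :: "'a \<Rightarrow> real"
  assumes "lsc f" and h: "continuous_on UNIV h"
  shows "open {z. c < f z + ereal (h z)}"
proof (subst open_subopen, safe)
  fix z assume z: "c < f z + ereal (h z)"
  then have "c - ereal (h z) < f z" by (cases c; cases "f z") auto
  \<comment> \<open>An intermediate \<open>y\<close>, necessarily finite, separates the two terms:
    lower semicontinuity keeps \<open>f\<close> above \<open>y\<close> near \<open>z\<close>, and
    continuity of \<open>h\<close> keeps \<open>y + h\<close> above \<open>c\<close>.\<close>
  then obtain y where y: "c - ereal (h z) < y" "y < f z" using dense by blast
  have "eventually (\<lambda>w. y < f w) (nhds z)"
    using \<open>lsc f\<close> y(2) by (auto simp: lsc_def le_Liminf_iff)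
  moreover have "eventually (\<lambda>w. c < y + ereal (h w)) (nhds z)"
  proof -
    have "(h \<longlongrightarrow> h z) (nhds z)"
      using h by (metis UNIV_I continuous_on_def tendsto_at_iff_tendsto_nhds)
    then have "((\<lambda>w. y + ereal (h w)) \<longlongrightarrow> y + ereal (h z)) (nhds z)"
      by (intro tendsto_intros tendsto_add_ereal_general) auto
    moreover have "c < y + ereal (h z)" using y by (cases c; cases y) auto
    ultimately show ?thesis by (rule order_tendstoD)
  qed
  ultimately have "eventually (\<lambda>w. c < f w + ereal (h w)) (nhds z)"
  proof eventually_elim
    case (elim w)
    then show ?case by (meson add_right_mono less_imp_le order_less_le_trans)
  qed
  then show "\<exists>T. open T \<and> z \<in> T \<and> T \<subseteq> {z. c < f z + ereal (h z)}"
    unfolding eventually_nhds by blast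
qed

lemma lsc_penalised_attains_min:
  fixes f :: "'a::euclidean_space \<Rightarrow> ereal"
  assumes "lsc f" and a: "f a \<le> ereal M" and lower: "\<And>w. ereal (- M) \<le> f w" and K: "K > 0"
  shows "\<exists>z. \<forall>w. f z + ereal (K * norm (z - y)) \<le> f w + ereal (K * norm (w - y))"
proof -
  define g where "g = (\<lambda>w. f w + ereal (K * norm (w - y)))"
  \<comment> \<open>Beyond radius \<open>R\<close> the penalty exceeds that at \<open>a\<close> by
    at least \<open>2 * \<bar>M\<bar>\<close>, which makes up for a drop of \<open>f\<close> from
    \<open>M\<close> to \<open>- M\<close>; so a minimiser over the compact ball is a global
    one.\<close>
  define R where "R = norm (a - y) + 2 * \<bar>M\<bar> / K"
  have R: "norm (a - y) \<le> R" "K * R = K * norm (a - y) + 2 * \<bar>M\<bar>"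
    using K by (auto simp: R_def field_simps)
  have op: "open {z. c < g z}" for c
    unfolding g_def by (intro lsc_add_continuous_open_superlevel assms continuous_intros)
  have aR: "a \<in> cball y R" using R by (simp add: dist_norm norm_minus_commute)
  then have "cball y R \<noteq> {}" by blast
  then obtain z where z: "z \<in> cball y R" "\<And>w. w \<in> cball y R \<Longrightarrow> g z \<le> g w"
    using compact_attains_inf_of_open_superlevel[OF compact_cball _ op] by metis
  have "g z \<le> g w" for w
  proof (cases "w \<in> cball y R")
    case False
    then have "K * R \<le> K * norm (w - y)"
      using K by (intro mult_left_mono) (auto simp: dist_norm norm_minus_commute)
    then have *: "M + K * norm (a - y) \<le> - M + K * norm (w - y)" using R(2) by linarith
    have "g z \<le> g a" using z aR by blast
    also have "\<dots> \<le> ereal M + ereal (K * norm (a - y))"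
      unfolding g_def using a by (rule add_right_mono)
    also have "\<dots> \<le> ereal (- M) + ereal (K * norm (w - y))" using * by simp
    also have "\<dots> \<le> g w" unfolding g_def using lower by (rule add_right_mono)
    finally show ?thesis .
  qed (use z in auto)
  then show ?thesis unfolding g_def by blast
qed

text \<open>First-order expansion of the norm at \<open>b\<close> with quadratic error, from the
  inequality between arithmetic and geometric means. It turns minimality of the penalised function
  into a quadratic minorant.\<close>

lemma norm_add_le_quadratic:
  fixes b h :: "'a::real_inner"
  assumes "b \<noteq> 0"
  shows "norm (b + h) \<le> norm b + b \<bullet> h / norm b + (norm h)\<^sup>2 / (2 * norm b)"
proof -
  have "2 * norm b * norm (b + h) \<le> (norm b)\<^sup>2 + (norm (b + h))\<^sup>2"
    using sum_squares_bound[of "norm b" "norm (b + h)"] by simp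
  also have "\<dots> = 2 * (norm b)\<^sup>2 + 2 * (b \<bullet> h) + (norm h)\<^sup>2"
    by (simp add: power2_norm_eq_inner inner_simps inner_commute)
  finally show ?thesis using assms by (simp add: field_simps power2_eq_square)
qed

text \<open>The one-sided form makes sense for infinite values: a \<open>w\<close> in the domain
  yields finiteness of \<open>f y\<close>, and exchanging \<open>y\<close> and \<open>w\<close> then
  yields the Lipschitz property.\<close>

lemma bounded_clarke_subdiff_imp_le:
  fixes f :: "'a::euclidean_space \<Rightarrow> ereal"
  assumes "lsc f" and dom: "f a \<le> ereal M" and lower: "\<And>w. ereal (- M) \<le> f w"
    and bound: "\<And>v p. p \<in> clarke_subdiff f v \<Longrightarrow> norm p \<le> \<delta>"
    and K: "K > \<delta>" "K > 0"
  shows "f y \<le> f w + ereal (K * norm (w - y))"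
proof -
  obtain z where z: "\<And>w. f z + ereal (K * norm (z - y)) \<le> f w + ereal (K * norm (w - y))"
    using lsc_penalised_attains_min[OF \<open>lsc f\<close> dom lower K(2), of y] by blast
  have "f z + ereal (K * norm (z - y)) \<le> ereal M + ereal (K * norm (a - y))"
    using z[of a] dom by (meson add_right_mono order_trans)
  then obtain r where r: "f z = ereal r" using lower[of z] by (cases "f z") auto
  have "z = y"
  proof (rule ccontr)
    assume "z \<noteq> y"
    define b where "b = z - y"
    \<comment> \<open>Minus the gradient of the penalty \<open>K * norm (w - y)\<close> at
      \<open>w = z\<close>.\<close>
    define p where "p = - (K / norm b) *\<^sub>R b"
    have b: "b \<noteq> 0" "norm b > 0" using \<open>z \<noteq> y\<close> by (auto simp: b_def)
    have "blinfun_inner_right p \<in> clarke_subdiff f z"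
    proof (rule proximal_subgradient_in_clarke_subdiff[of f z r, OF r])
      show "K / (2 * norm b) \<ge> 0" using K by simp
      fix w
      have "norm (w - y) \<le> norm b + b \<bullet> (w - z) / norm b + (norm (w - z))\<^sup>2 / (2 * norm b)"
        using norm_add_le_quadratic[OF b(1), of "w - z"] by (simp add: b_def)
      from mult_left_mono[OF this less_imp_le[OF K(2)]]
      have "K * norm (w - y) \<le> K * norm b - p \<bullet> (w - z) + K / (2 * norm b) * (norm (w - z))\<^sup>2"
        by (simp add: p_def algebra_simps diff_divide_distrib)
      then show "ereal (r + blinfun_inner_right p (w - z) - K / (2 * norm b) * (norm (w - z))\<^sup>2) \<le> f w"
        using z[of w] r by (cases "f w") (auto simp: b_def)
    qed
    then have "norm (blinfun_inner_right p) \<le> \<delta>" by (rule bound)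
    \<comment> \<open>Evaluating the functional at \<open>p\<close> itself shows that its norm is at
      least \<open>norm p\<close>.\<close>
    moreover have "norm p * norm p \<le> norm (blinfun_inner_right p) * norm p"
      using norm_blinfun[of "blinfun_inner_right p" p] by (simp add: norm_eq_sqrt_inner)
    moreover have "norm p = K" using b K by (simp add: p_def)
    ultimately show False using K by simp
  qed
  then show ?thesis using z[of w] by (simp add: zero_ereal_def[symmetric])
qed

section \<open>Convergence of the integrals\<close>

lemma eintegral_eq_integral:
  assumes "integrable M g"
  shows "eintegral M (\<lambda>s. ereal (g s)) = ereal (integral\<^sup>L M g)"
proof -
  have fin: "(\<integral>\<^sup>+ s. ennreal (g s) \<partial>M) < top" "(\<integral>\<^sup>+ s. ennreal (- g s) \<partial>M) < top"
    using assms by (auto simp: real_integrable_def less_top)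
  then show ?thesis
    unfolding eintegral_def real_lebesgue_integral_def[OF assms]
    by (cases "\<integral>\<^sup>+ s. ennreal (g s) \<partial>M"; cases "\<integral>\<^sup>+ s. ennreal (- g s) \<partial>M") auto
qed

text \<open>Where \<open>xs n\<close> is within \<open>\<eta>\<close> of \<open>x\<close>, the
  Lipschitz bound makes the integrands differ by at most \<open>K * \<eta>\<close>; elsewhere they
  differ by at most \<open>2 * B\<close>, on a set whose measure tends to 0.\<close>

lemma (in finite_measure) tendsto_integral_of_tendsto_in_measure:
  fixes f :: "'e::{real_normed_vector,second_countable_topology} \<Rightarrow> real"
  assumes [measurable]: "\<And>n. xs n \<in> borel_measurable M" "x \<in> borel_measurable M"
    and f [measurable]: "f \<in> borel_measurable borel"
    and lim: "tendsto_in_measure M xs x"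
    and lip: "\<And>v w. \<bar>f v - f w\<bar> \<le> K * norm (v - w)" and bd: "\<And>v. \<bar>f v\<bar> \<le> B"
    and K: "K > 0"
  shows "(\<lambda>n. \<integral>s. f (xs n s) \<partial>M) \<longlonglongrightarrow> (\<integral>s. f (x s) \<partial>M)"
proof (rule LIMSEQ_I)
  fix e :: real assume e: "e > 0"
  define m where "m = measure M (space M)"
  \<comment> \<open>Keeps the Lipschitz part below \<open>e / 2\<close>; dividing by
    \<open>m + 1\<close> instead of \<open>m\<close> covers \<open>m = 0\<close>.\<close>
  define \<eta> where "\<eta> = e / (2 * K * (m + 1))"
  have m: "m \<ge> 0" by (simp add: m_def)
  have "\<eta> > 0" using e K m by (simp add: \<eta>_def)
  moreover from this have "K * \<eta> * m < K * \<eta> * (m + 1)" using K by simp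
  moreover have "K * \<eta> * (m + 1) = e / 2" using K m by (simp add: \<eta>_def divide_simps)
  ultimately have \<eta>: "\<eta> > 0" "K * \<eta> * m < e / 2" by simp_all
  define D where "D n = {s \<in> space M. norm (xs n s - x s) \<ge> \<eta>}" for n
  have [measurable]: "D n \<in> sets M" for n unfolding D_def by measurable
  have int: "integrable M (\<lambda>s. f (z s))" if [measurable]: "z \<in> borel_measurable M" for z
    by (rule integrable_const_bound[of _ B]) (use bd in auto)
  have "(\<lambda>n. 2 * B * measure M (D n)) \<longlonglongrightarrow> 2 * B * 0"
    using lim \<eta>(1) unfolding tendsto_in_measure_def D_def by (intro tendsto_intros) auto
  then have "eventually (\<lambda>n. 2 * B * measure M (D n) < e / 2) sequentially"
    using e by (intro order_tendstoD) auto
  moreover have "\<bar>(\<integral>s. f (xs n s) \<partial>M) - (\<integral>s. f (x s) \<partial>M)\<bar> \<le> K * \<eta> * m + 2 * B * measure M (D n)" for n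
  proof -
    have "\<bar>f (xs n s) - f (x s)\<bar> \<le> K * \<eta> + 2 * B * indicator (D n) s" if "s \<in> space M" for s
    proof (cases "s \<in> D n")
      case True
      have "\<bar>f (xs n s) - f (x s)\<bar> \<le> 2 * B" using bd[of "xs n s"] bd[of "x s"] by linarith
      then show ?thesis using True K \<eta>(1) by (simp add: add_increasing)
    next
      case False
      then have "K * norm (xs n s - x s) \<le> K * \<eta>"
        using that K by (intro mult_left_mono) (auto simp: D_def)
      then show ?thesis using False lip[of "xs n s" "x s"] by simp
    qed
    moreover have "integrable M (\<lambda>s. f (xs n s) - f (x s))" by (simp add: int)
    moreover have ii: "integrable M (\<lambda>s. 2 * B * indicator (D n) s)"
      by (simp add: less_top[symmetric])
    ultimately have "(\<integral>s. \<bar>f (xs n s) - f (x s)\<bar> \<partial>M) \<le> (\<integral>s. K * \<eta> + 2 * B * indicator (D n) s \<partial>M)"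
      by (intro integral_mono) auto
    also have "\<dots> = K * \<eta> * m + 2 * B * measure M (D n)"
      by (subst Bochner_Integration.integral_add[OF _ ii]) (auto simp: m_def)
    finally have "(\<integral>s. \<bar>f (xs n s) - f (x s)\<bar> \<partial>M) \<le> \<dots>" .
    then show ?thesis
      using integral_abs_bound[of M "\<lambda>s. f (xs n s) - f (x s)"] by (simp add: int)
  qed
  ultimately have "eventually (\<lambda>n. norm ((\<integral>s. f (xs n s) \<partial>M) - (\<integral>s. f (x s) \<partial>M)) < e) sequentially"
  proof (elim eventually_mono)
    fix n assume "2 * B * measure M (D n) < e / 2"
      and "\<And>n. \<bar>(\<integral>s. f (xs n s) \<partial>M) - (\<integral>s. f (x s) \<partial>M)\<bar> \<le> K * \<eta> * m + 2 * B * measure M (D n)"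
    from this(1) this(2)[of n] \<eta>(2)
    show "norm ((\<integral>s. f (xs n s) \<partial>M) - (\<integral>s. f (x s) \<partial>M)) < e"
      unfolding real_norm_def by linarith
  qed
  then show "\<exists>no. \<forall>n\<ge>no. norm ((\<integral>s. f (xs n s) \<partial>M) - (\<integral>s. f (x s) \<partial>M)) < e"
    by (simp add: eventually_sequentially)
qed

theorem theorem7p5:
  fixes \<mu> :: "'s measure"
    and \<phi> :: "real ^ 'd \<Rightarrow> ereal"
    and xs :: "nat \<Rightarrow> 's \<Rightarrow> real ^ 'd"
    and x :: "'s \<Rightarrow> real ^ 'd"
  assumes "complete_measure \<mu>"
    and "finite_measure \<mu>"
    and "emeasure \<mu> (space \<mu>) \<noteq> 0"
    and "\<And>v. \<phi> v \<noteq> -\<infinity>"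
    and "proper \<phi>"
    and "lsc \<phi>"
    and "\<And>n. xs n \<in> dom_int_functional \<mu> \<phi>"
    and "x \<in> dom_int_functional \<mu> \<phi>"
    and "\<exists>\<delta>>0. \<forall>(v, vs) \<in> gra (clarke_subdiff \<phi>). norm vs \<le> \<delta>"
    and "tendsto_in_measure \<mu> xs x"
    and "\<exists>M>0. \<forall>v \<in> edom \<phi>. \<bar>\<phi> v\<bar> \<le> ereal M"
  shows "(\<lambda>n. int_functional \<mu> \<phi> (xs n)) \<longlonglongrightarrow> int_functional \<mu> \<phi> x"
proof -
  interpret finite_measure \<mu> by fact
  obtain \<delta> where \<delta>: "\<delta> > 0" "\<And>v p. p \<in> clarke_subdiff \<phi> v \<Longrightarrow> norm p \<le> \<delta>"
    using assms(9) by (auto simp: gra_def)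
  obtain M where M: "M > 0" "\<And>v. \<phi> v < \<infinity> \<Longrightarrow> \<bar>\<phi> v\<bar> \<le> ereal M"
    using assms(11) by (auto simp: edom_def)
  obtain a where a: "\<phi> a < \<infinity>" using \<open>proper \<phi>\<close> by (auto simp: proper_def edom_def)
  have upper_a: "\<phi> a \<le> ereal M" using M(2)[OF a] by (cases "\<phi> a") auto
  \<comment> \<open>Outside the domain the value is \<infinity>, so the lower bound holds
    everywhere.\<close>
  have lower: "ereal (- M) \<le> \<phi> w" for w
    using M(2)[of w] assms(4)[of w] by (cases "\<phi> w") auto
  define K where "K = \<delta> + 1"
  have K: "K > \<delta>" "K > 0" using \<delta>(1) by (auto simp: K_def)
  have le: "\<phi> y \<le> \<phi> w + ereal (K * norm (w - y))" for y w
    by (rule bounded_clarke_subdiff_imp_le[OF \<open>lsc \<phi>\<close> upper_a lower \<delta>(2) K])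
  have fin: "\<phi> y < \<infinity>" for y using le[of y a] a by (cases "\<phi> a") auto
  define f where "f v = real_of_ereal (\<phi> v)" for v
  have \<phi>: "\<phi> v = ereal (f v)" for v
    using fin[of v] assms(4)[of v] by (cases "\<phi> v") (auto simp: f_def)
  have bd: "\<bar>f v\<bar> \<le> M" for v using M(2)[OF fin[of v]] by (simp add: \<phi>)
  have lip: "\<bar>f v - f w\<bar> \<le> K * norm (v - w)" for v w
    using le[of v w] le[of w v] by (simp add: \<phi> norm_minus_commute abs_le_iff)
  have "K-lipschitz_on UNIV f"
    using lip K by (intro lipschitz_onI) (auto simp: dist_norm)
  then have [measurable]: "f \<in> borel_measurable borel"
    by (intro borel_measurable_continuous_onI lipschitz_on_continuous_on)
  have meas [measurable]: "xs n \<in> borel_measurable \<mu>" "x \<in> borel_measurable \<mu>" for n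
    using assms(7)[of n] assms(8) by (auto simp: dom_int_functional_def)
  \<comment> \<open>A bounded measurable integrand is integrable over a finite measure, so the
    extended integral is an ordinary one.\<close>
  have I: "int_functional \<mu> \<phi> z = ereal (\<integral>s. f (z s) \<partial>\<mu>)" if [measurable]: "z \<in> borel_measurable \<mu>" for z
    unfolding int_functional_def \<phi>
    by (intro eintegral_eq_integral integrable_const_bound[of _ M]) (use bd in auto)
  show ?thesis
    unfolding I[OF meas(1)] I[OF meas(2)]
    by (intro tendsto_intros tendsto_integral_of_tendsto_in_measure[OF meas _ assms(10) lip bd K(2)]) auto
qed

end
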